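(* Let $G$ and $H$ be connected graphs such that at least one of $G$, $H$ has at least three vertices (and each has at least two vertices). Then $\chi_{lid}(G \times H) \leq \chi(G)\,\chi(H)$.
   Context: $\chi(G)$ is the chromatic number of $G$. A proper $k$-coloring of a graph $G$ is a map $f:V(G)\to\{1,\dots,k\}$ with $f(u)\neq f(v)$ for every edge $uv$. For a vertex $v$, $N[v]$ denotes its closed neighborhood ($v$ together with all its neighbors), and $f(S)=\{f(x):x\in S\}$. A locally identifying coloring (lid-coloring) of $G$ is a proper coloring $f$ such that for every edge $uv$ with $N[u]\neq N[v]$ we have $f(N[u])\neq f(N[v])$. The lid-chromatic number $\chi_{lid}(G)$ is the smallest $k$ such that $G$ has a lid-coloring with $k$ colors. The tensor product $G\times H$ has vertex set $V(G)\times V(H)$, where $(u_1,v_1)$ and $(u_2,v_2)$ are adjacent iff $u_1u_2\in E(G)$ and $v_1v_2\in E(H)$. *)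

theory Defs
  imports "Graph_Theory.Digraph_Component"
begin

text \<open>
  Finite simple graphs are modelled as instances of the locale \<^locale>\<open>pair_graph\<close>:
  finite, loop-free, symmetric digraphs whose arcs are pairs of vertices. An edge \<open>uv\<close> is
  the pair of arcs \<open>(u, v)\<close> and \<open>(v, u)\<close>.
\<close>

definition proper_coloring :: "'a pair_pre_digraph \<Rightarrow> nat \<Rightarrow> ('a \<Rightarrow> nat) \<Rightarrow> bool" where
  "proper_coloring G k f \<longleftrightarrow>
     f ` pverts G \<subseteq> {1..k} \<and> (\<forall>(u, v) \<in> parcs G. f u \<noteq> f v)"

definition chromatic_number :: "'a pair_pre_digraph \<Rightarrow> nat" where
  "chromatic_number G = (LEAST k. \<exists>f. proper_coloring G k f)"

definition closed_nbhd :: "'a pair_pre_digraph \<Rightarrow> 'a \<Rightarrow> 'a set" where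
  "closed_nbhd G v = insert v {w. (v, w) \<in> parcs G}"

definition lid_coloring :: "'a pair_pre_digraph \<Rightarrow> nat \<Rightarrow> ('a \<Rightarrow> nat) \<Rightarrow> bool" where
  "lid_coloring G k f \<longleftrightarrow>
     proper_coloring G k f \<and>
     (\<forall>(u, v) \<in> parcs G. closed_nbhd G u \<noteq> closed_nbhd G v \<longrightarrow>
        f ` closed_nbhd G u \<noteq> f ` closed_nbhd G v)"

definition lid_chromatic_number :: "'a pair_pre_digraph \<Rightarrow> nat" where
  "lid_chromatic_number G = (LEAST k. \<exists>f. lid_coloring G k f)"

definition tensor_product ::
  "'a pair_pre_digraph \<Rightarrow> 'b pair_pre_digraph \<Rightarrow> ('a \<times> 'b) pair_pre_digraph" where
  "tensor_product G H =
     \<lparr> pverts = pverts G \<times> pverts H,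
       parcs = {((u1, v1), (u2, v2)) | u1 v1 u2 v2.
                  (u1, u2) \<in> parcs G \<and> (v1, v2) \<in> parcs H} \<rparr>"

lemma pair_graph_tensor_product:
  assumes "pair_graph G" "pair_graph H"
  shows "pair_graph (tensor_product G H)"
proof -
  interpret G: pair_graph G by fact
  interpret H: pair_graph H by fact
  have sub: "parcs (tensor_product G H) \<subseteq> (pverts G \<times> pverts H) \<times> (pverts G \<times> pverts H)"
    by (auto simp: tensor_product_def dest: G.in_arcsD1 G.in_arcsD2 H.in_arcsD1 H.in_arcsD2)
  show ?thesis
  proof
    show "finite (pverts (tensor_product G H))"
      by (simp add: tensor_product_def)
    show "finite (parcs (tensor_product G H))"
      by (rule finite_subset[OF sub]) simp
    show "symmetric (with_proj (tensor_product G H))"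
      using G.sym_arcs H.sym_arcs
      by (auto simp: symmetric_def tensor_product_def sym_def)
  qed (auto simp: tensor_product_def dest: G.in_arcsD1 G.in_arcsD2 H.in_arcsD1 H.in_arcsD2 G.pair_no_loops)
qed

text \<open>
  An injective coloring is a lid-coloring, so for finite simple graphs both \<open>LEAST\<close> above range
  over nonempty sets.
\<close>

lemma lid_coloring_exists:
  assumes "pair_graph G"
  shows "\<exists>f. lid_coloring G (card (pverts G)) f"
proof -
  interpret pair_graph G by fact
  obtain f where f: "bij_betw f (pverts G) {1..card (pverts G)}"
    using finite_same_card_bij[of "pverts G" "{1..card (pverts G)}"] by auto
  then have inj: "inj_on f (pverts G)" and im: "f ` pverts G = {1..card (pverts G)}"
    by (auto simp: bij_betw_def)
  have nb: "closed_nbhd G v \<subseteq> pverts G" if "v \<in> pverts G" for v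
    using that in_arcsD2 by (auto simp: closed_nbhd_def)
  have "lid_coloring G (card (pverts G)) f"
    unfolding lid_coloring_def proper_coloring_def
  proof (intro conjI ballI)
    fix e assume "e \<in> parcs G"
    moreover obtain u v where e: "e = (u, v)" by force
    ultimately have uv: "u \<in> pverts G" "v \<in> pverts G" "u \<noteq> v"
      using in_arcsD1 in_arcsD2 pair_no_loops[of e] by auto
    show "case e of (u, v) \<Rightarrow> f u \<noteq> f v"
      using uv inj e by (auto dest: inj_onD)
    show "case e of (u, v) \<Rightarrow> closed_nbhd G u \<noteq> closed_nbhd G v \<longrightarrow>
        f ` closed_nbhd G u \<noteq> f ` closed_nbhd G v"
      using inj_on_image_eq_iff[OF inj nb nb] uv e by simp
  qed (use im in simp)
  then show ?thesis by blast
qed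

end

theory Submission
  imports Defs
begin

text \<open>
  If one factor is bipartite, so is the product, and no component of the product is a single edge.
  Such a graph has a lid-coloring with four colors: label the vertices of each component by levels
  modulo 4, starting from a root all of whose neighbours have degree at least two, such that levels
  of adjacent vertices differ in parity and every vertex \<open>v\<close> but the root has a neighbour on
  the level preceding its own. That level then occurs around \<open>v\<close>, but not around a neighbour
  of \<open>v\<close> on the level following that of \<open>v\<close>.

  Otherwise both chromatic numbers are at least 3. The product of two optimal colorings
  \<open>f\<close> and \<open>g\<close> need not be a lid-coloring (in the product of two 5-cycles it never is).
  Take \<open>f\<close> and \<open>g\<close> greedy, i.e. every vertex sees all colors below its own. Then only edges
  inside \<open>S = X \<times> Y\<close> can fail to be distinguished, where \<open>X\<close> and \<open>Y\<close> consist of the vertices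
  whose closed neighbourhood uses colors 1 and 2 only. The set \<open>S\<close> is recolored by levels
  modulo 4 grown inwards from its complement: levels 0 and 1 keep the product color, level 2 gets
  \<open>(3, 3)\<close> and level 3 gets \<open>(1, g v)\<close>. Vertices of \<open>S\<close> with a neighbour outside are put
  on levels 1 and 2, so that the complement of \<open>S\<close> only sees the new color \<open>(3, 3)\<close>.
\<close>

section \<open>Connected symmetric graphs and their tensor products\<close>

lemma pair_graph_arcD:
  assumes "pair_graph G" "(u, v) \<in> parcs G"
  shows "u \<in> pverts G" "v \<in> pverts G" "u \<noteq> v" "(v, u) \<in> parcs G"
proof -
  interpret pair_graph G by fact
  show "u \<in> pverts G" "v \<in> pverts G" "u \<noteq> v" "(v, u) \<in> parcs G"
    using assms(2) in_arcsD1 in_arcsD2 pair_no_loops[of "(u, v)"] sym_arcs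
    by (auto simp: symmetric_def sym_def)
qed

text \<open>Symmetry upgrades connectedness to strong connectedness, so a walk starting in
  \<open>A\<close> reaches every vertex without ever leaving \<open>A\<close>.\<close>

lemma connected_closed_subset_eq:
  assumes G: "pair_graph G" and conn: "Digraph_Component.connected (with_proj G)"
    and A: "A \<subseteq> pverts G" "A \<noteq> {}"
    and closed: "\<And>u v. u \<in> A \<Longrightarrow> (u, v) \<in> parcs G \<Longrightarrow> v \<in> A"
  shows "A = pverts G"
proof
  interpret pair_graph G by fact
  obtain u where u: "u \<in> A" using A by blast
  have sc: "strongly_connected (with_proj G)"
    using symmetric_connected_imp_strongly_connected[OF sym_arcs conn] .
  show "pverts G \<subseteq> A"
  proof
    fix v assume "v \<in> pverts G"
    with sc u A have "u \<rightarrow>\<^sup>*\<^bsub>with_proj G\<^esub> v" by (auto simp: strongly_connected_def)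
    then have "(u, v) \<in> (parcs G)\<^sup>*" using reachable_rtranclI by force
    then show "v \<in> A" by (induction rule: rtrancl_induct) (use u closed in auto)
  qed
qed (rule A)

lemma connected_has_neighbour:
  assumes "pair_graph G" "Digraph_Component.connected (with_proj G)"
    and "card (pverts G) \<ge> 2" "v \<in> pverts G"
  shows "\<exists>w. (v, w) \<in> parcs G"
proof (rule ccontr)
  assume "\<not> ?thesis"
  then have "{v} = pverts G"
    using assms by (intro connected_closed_subset_eq) auto
  then show False using assms(3) by (metis card.empty card.insert empty_iff finite.emptyI
      One_nat_def Suc_1 Suc_n_not_le_n)
qed

lemma tensor_product_arc_iff [simp]:
  "((a, b), (a', b')) \<in> parcs (tensor_product G H) \<longleftrightarrow> (a, a') \<in> parcs G \<and> (b, b') \<in> parcs H"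
  by (auto simp: tensor_product_def)

lemma pverts_tensor_product [simp]: "pverts (tensor_product G H) = pverts G \<times> pverts H"
  by (simp add: tensor_product_def)

text \<open>If \<open>p = (a, b)\<close> and \<open>q = (a', b')\<close> had no other neighbours,
  any neighbour \<open>v\<close> of \<open>a\<close> would give the neighbour \<open>(v, b')\<close>
  of \<open>p\<close>, forcing \<open>v = a'\<close>. Thus \<open>{a, a'}\<close> and likewise
  \<open>{b, b'}\<close> are closed under adjacency, and both factors have at most two
  vertices.\<close>

lemma tensor_product_no_isolated_edge:
  assumes G: "pair_graph G" "Digraph_Component.connected (with_proj G)"
    and H: "pair_graph H" "Digraph_Component.connected (with_proj H)"
    and card: "card (pverts G) \<ge> 3 \<or> card (pverts H) \<ge> 3"
    and pq: "(p, q) \<in> parcs (tensor_product G H)"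
  shows "(\<exists>r. r \<noteq> q \<and> (p, r) \<in> parcs (tensor_product G H)) \<or>
         (\<exists>r. r \<noteq> p \<and> (q, r) \<in> parcs (tensor_product G H))"
proof (rule ccontr)
  assume neg: "\<not> ?thesis"
  obtain a b a' b' where eq: "p = (a, b)" "q = (a', b')" by (cases p, cases q)
  have arcs: "(a, a') \<in> parcs G" "(b, b') \<in> parcs H" using pq eq by auto
  note Ga = pair_graph_arcD[OF G(1) arcs(1)] and Ha = pair_graph_arcD[OF H(1) arcs(2)]
  have "{a, a'} = pverts G"
  proof (rule connected_closed_subset_eq[OF G])
    fix u v assume "u \<in> {a, a'}" "(u, v) \<in> parcs G"
    then show "v \<in> {a, a'}" using neg arcs Ha eq by fastforce
  qed (use Ga in auto)
  moreover have "{b, b'} = pverts H"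
  proof (rule connected_closed_subset_eq[OF H])
    fix u v assume "u \<in> {b, b'}" "(u, v) \<in> parcs H"
    then show "v \<in> {b, b'}" using neg arcs Ga eq by fastforce
  qed (use Ha in auto)
  moreover have "card {a, a'} \<le> 2" "card {b, b'} \<le> 2" by (simp_all add: card_insert_if)
  ultimately show False using card by auto
qed

section \<open>Bounds on the two chromatic numbers\<close>

lemma proper_coloring_chromatic_number:
  assumes "pair_graph G"
  shows "\<exists>f. proper_coloring G (chromatic_number G) f"
  unfolding chromatic_number_def
  by (rule LeastI_ex) (use lid_coloring_exists[OF assms] in \<open>auto simp: lid_coloring_def\<close>)

lemma chromatic_number_le: "proper_coloring G k f \<Longrightarrow> chromatic_number G \<le> k"
  unfolding chromatic_number_def by (rule Least_le) blast

lemma lid_chromatic_number_le: "lid_coloring G k f \<Longrightarrow> lid_chromatic_number G \<le> k"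
  unfolding lid_chromatic_number_def by (rule Least_le) blast

lemma chromatic_number_ge_2:
  assumes "pair_graph G" "(u, v) \<in> parcs G"
  shows "chromatic_number G \<ge> 2"
proof -
  obtain f where "proper_coloring G (chromatic_number G) f"
    using proper_coloring_chromatic_number assms(1) by blast
  then have "f u \<in> {1..chromatic_number G}" "f v \<in> {1..chromatic_number G}" "f u \<noteq> f v"
    using assms(2) pair_graph_arcD[OF assms] unfolding proper_coloring_def by blast+
  then show ?thesis by auto
qed

text \<open>Numbering \<open>C\<close> injectively preserves all inequalities. This lets levels and
  pairs of colors serve directly as colors.\<close>

lemma lid_chromatic_number_le_card:
  assumes G: "pair_graph G" and C: "finite C" "c ` pverts G \<subseteq> C"
    and proper: "\<And>u v. (u, v) \<in> parcs G \<Longrightarrow> c u \<noteq> c v"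
    and lid: "\<And>u v. (u, v) \<in> parcs G \<Longrightarrow> c ` closed_nbhd G u \<noteq> c ` closed_nbhd G v"
  shows "lid_chromatic_number G \<le> card C"
proof -
  obtain h where h: "bij_betw h C {1..card C}"
    using finite_same_card_bij[of C "{1..card C}"] C by auto
  then have inj: "inj_on h C" and im: "h ` C = {1..card C}" by (auto simp: bij_betw_def)
  have nb: "c ` closed_nbhd G v \<subseteq> C" if "v \<in> pverts G" for v
    using that C(2) pair_graph_arcD[OF G] by (auto simp: closed_nbhd_def)
  have "lid_coloring G (card C) (h \<circ> c)"
    unfolding lid_coloring_def proper_coloring_def
  proof (intro conjI ballI)
    show "(h \<circ> c) ` pverts G \<subseteq> {1..card C}" using im C(2) by auto
    fix e assume "e \<in> parcs G"
    moreover obtain u v where e: "e = (u, v)" by force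
    ultimately have uv: "(u, v) \<in> parcs G" "u \<in> pverts G" "v \<in> pverts G"
      using pair_graph_arcD[OF G] by auto
    show "case e of (u, v) \<Rightarrow> (h \<circ> c) u \<noteq> (h \<circ> c) v"
      using proper[OF uv(1)] uv C(2) inj e by (auto simp: inj_on_eq_iff image_subset_iff)
    show "case e of (u, v) \<Rightarrow> closed_nbhd G u \<noteq> closed_nbhd G v \<longrightarrow>
        (h \<circ> c) ` closed_nbhd G u \<noteq> (h \<circ> c) ` closed_nbhd G v"
      using inj_on_image_eq_iff[OF inj nb nb] uv e lid[OF uv(1)] by (simp add: image_image o_def)
  qed
  then show ?thesis by (rule lid_chromatic_number_le)
qed

section \<open>Levels modulo 4\<close>

text \<open>This is what the modulus 4 is for: modulo 2, the levels before and after a vertex would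
  coincide. Below, \<open>a\<close> is the level of a parent, \<open>b\<close> that of a vertex and
  \<open>c\<close> that of a neighbour one level up.\<close>

lemma mod_4_succ_succ:
  fixes a b c :: nat
  assumes "a < 4" "b = (a + 1) mod 4" "c = (b + 1) mod 4"
  shows "a mod 2 = c mod 2" "a \<noteq> c"
proof -
  consider "a = 0" | "a = 1" | "a = 2" | "a = 3" using assms(1) by linarith
  then show "a mod 2 = c mod 2" "a \<noteq> c" using assms(2,3) by (cases; simp)+
qed

lemma mod_4_consecutive:
  fixes a b :: nat
  assumes "a < 4" "b < 4" "a mod 2 \<noteq> b mod 2"
  shows "b = (a + 1) mod 4 \<or> a = (b + 1) mod 4"
proof -
  have "a \<in> {0, 1, 2, 3}" "b \<in> {0, 1, 2, 3}" using assms(1,2) by auto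
  then show ?thesis using assms(3) by auto
qed

text \<open>Labels are added one vertex at a time: \<open>step\<close> yields an unlabelled
  \<open>v\<close> next to a labelled \<open>t\<close>, which becomes its parent, and
  \<open>flip\<close> keeps the parity of the new level equal to \<open>s v\<close>. Only edges at
  vertices outside \<open>T0\<close> must flip \<open>s\<close>, so that the lemma also applies when
  \<open>s\<close> is a bipartition of just a part of the graph.\<close>

lemma level_extension:
  fixes L0 s :: "'a \<Rightarrow> nat"
  assumes "finite V" "T0 \<subseteq> V"
    and step: "\<And>T. T0 \<subseteq> T \<Longrightarrow> T \<subset> V \<Longrightarrow> \<exists>v\<in>V - T. \<exists>t\<in>T. (v, t) \<in> E"
    and flip: "\<And>v t. v \<in> V - T0 \<Longrightarrow> t \<in> V \<Longrightarrow> (v, t) \<in> E \<Longrightarrow> s v = (s t + 1) mod 2"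
    and L0: "\<And>v. v \<in> T0 \<Longrightarrow> L0 v < 4 \<and> L0 v mod 2 = s v"
  obtains L where "\<And>v. v \<in> T0 \<Longrightarrow> L v = L0 v"
    and "\<And>v. v \<in> V \<Longrightarrow> L v < 4 \<and> L v mod 2 = s v"
    and "\<And>v. v \<in> V - T0 \<Longrightarrow> \<exists>t\<in>V. (v, t) \<in> E \<and> L v = (L t + 1) mod 4"
proof -
  have "\<exists>L. (\<forall>v\<in>T0. L v = L0 v) \<and> (\<forall>v\<in>V. L v < 4 \<and> L v mod 2 = s v) \<and>
      (\<forall>v\<in>V - T0. \<exists>t\<in>V. (v, t) \<in> E \<and> L v = (L t + 1) mod 4)"
    using assms(2-)
  proof (induction "card (V - T0)" arbitrary: T0 L0 rule: less_induct)
    case less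
    show ?case
    proof (cases "T0 = V")
      case True
      then show ?thesis using less.prems(4) by auto
    next
      case False
      then obtain v t where vt: "v \<in> V - T0" "t \<in> T0" "(v, t) \<in> E"
        using less.prems(1) less.prems(2)[of T0] by blast
      define L1 where "L1 = L0(v := (L0 t + 1) mod 4)"
      have "card (V - insert v T0) < card (V - T0)"
        using vt \<open>finite V\<close> by (intro psubset_card_mono) auto
      moreover have "L1 w < 4 \<and> L1 w mod 2 = s w" if "w \<in> insert v T0" for w
      proof (cases "w = v")
        case True
        have "t \<in> V" using vt less.prems(1) by blast
        then have "s v = (s t + 1) mod 2" using less.prems(3) vt by blast
        moreover have "L0 t mod 2 = s t" using less.prems(4) vt by blast
        moreover have "(L0 t + 1) mod 4 mod 2 = (L0 t + 1) mod 2" by (rule mod_mod_cancel) simp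
        ultimately have "(L0 t + 1) mod 4 mod 2 = s v" by (metis mod_add_left_eq)
        then show ?thesis using True unfolding L1_def by simp
      next
        case False
        then have "w \<in> T0" "L1 w = L0 w" using that by (simp_all add: L1_def)
        then show ?thesis using less.prems(4)[of w] by metis
      qed
      moreover have "insert v T0 \<subseteq> V" using vt less.prems(1) by blast
      moreover have "\<exists>v\<in>V - T. \<exists>t\<in>T. (v, t) \<in> E" if "insert v T0 \<subseteq> T" "T \<subset> V" for T
        using less.prems(2)[of T] that by blast
      moreover have "s w = (s t + 1) mod 2" if "w \<in> V - insert v T0" "t \<in> V" "(w, t) \<in> E" for w t
        using less.prems(3)[of w t] that by blast
      ultimately obtain L where L: "\<forall>w\<in>insert v T0. L w = L1 w"
        "\<forall>w\<in>V. L w < 4 \<and> L w mod 2 = s w"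
        "\<forall>w\<in>V - insert v T0. \<exists>t\<in>V. (w, t) \<in> E \<and> L w = (L t + 1) mod 4"
        using less.hyps[of "insert v T0" L1] by blast
      have "L w = L0 w" if "w \<in> T0" for w
        using L(1) that vt by (auto simp: L1_def)
      moreover have "\<exists>t\<in>V. (w, t) \<in> E \<and> L w = (L t + 1) mod 4" if "w \<in> V - T0" for w
        using L(1,3) that vt less.prems(1) by (cases "w = v") (auto simp: L1_def)
      ultimately show ?thesis using L(2) by blast
    qed
  qed
  then show ?thesis using that by blast
qed

section \<open>Bipartite graphs without isolated edges\<close>

lemma bipartite_lid_chromatic_number_le_4:
  fixes s :: "'a \<Rightarrow> nat"
  assumes G: "pair_graph G"
    and s: "\<And>v. v \<in> pverts G \<Longrightarrow> s v < 2"
    and s_edge: "\<And>u v. (u, v) \<in> parcs G \<Longrightarrow> s u \<noteq> s v"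
    and no_iso: "\<And>u v. (u, v) \<in> parcs G \<Longrightarrow>
      (\<exists>w. w \<noteq> v \<and> (u, w) \<in> parcs G) \<or> (\<exists>w. w \<noteq> u \<and> (v, w) \<in> parcs G)"
  shows "lid_chromatic_number G \<le> 4"
proof -
  let ?E = "parcs G" and ?V = "pverts G"
  interpret pair_graph G by fact
  note arcD = pair_graph_arcD[OF G]
  have s_flip: "s u = 1 - s v" if "(u, v) \<in> ?E" for u v
    using s_edge[OF that] s[of u] s[of v] arcD[OF that] by auto
  define good where "good r \<longleftrightarrow> (\<forall>u. (r, u) \<in> ?E \<longrightarrow> (\<exists>w. w \<noteq> r \<and> (u, w) \<in> ?E))" for r
  \<comment> \<open>If \<open>v\<close> is not good, it has a neighbour \<open>u\<close> whose only
    neighbour is \<open>v\<close>. As \<open>uv\<close> is not an isolated edge, \<open>v\<close>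
    has a further neighbour, so \<open>u\<close> is good.\<close>
  have ex_good: "\<exists>r. (v, r) \<in> ?E\<^sup>* \<and> good r" for v
  proof (cases "good v")
    case False
    then obtain u where u: "(v, u) \<in> ?E" "\<And>w. (u, w) \<in> ?E \<Longrightarrow> w = v"
      unfolding good_def by blast
    have "good u" unfolding good_def using u no_iso[OF u(1)] by blast
    then show ?thesis using u(1) by blast
  qed blast
  \<comment> \<open>The choice depends only on the set of vertices reachable from \<open>v\<close>,
    so each component gets exactly one root.\<close>
  define \<rho> where "\<rho> v = (SOME r. (v, r) \<in> ?E\<^sup>* \<and> good r)" for v
  have \<rho>: "(v, \<rho> v) \<in> ?E\<^sup>*" "good (\<rho> v)" for v
    using someI_ex[OF ex_good[of v]] unfolding \<rho>_def by auto
  have sym: "sym (?E\<^sup>*)"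
    by (rule sym_rtrancl) (use arcD in \<open>auto simp: sym_def\<close>)
  have \<rho>_eq: "\<rho> u = \<rho> v" if "(u, v) \<in> ?E\<^sup>*" for u v
  proof -
    have "(u, r) \<in> ?E\<^sup>* \<longleftrightarrow> (v, r) \<in> ?E\<^sup>*" for r
      using that symD[OF sym that] by (meson rtrancl_trans)
    then show ?thesis unfolding \<rho>_def by simp
  qed
  have E_\<rho>: "\<rho> u = \<rho> v" if "(u, v) \<in> ?E" for u v using \<rho>_eq that by blast
  define R where "R = {v \<in> ?V. \<rho> v = v}"
  define N1 where "N1 = {v. \<exists>r\<in>R. (r, v) \<in> ?E}"
  define N2 where "N2 = {v. \<exists>u\<in>N1. (u, v) \<in> ?E}"
  have R_unique: "r = r'" if "r \<in> R" "r' \<in> R" "\<rho> r = \<rho> r'" for r r'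
    using that by (auto simp: R_def)
  have RN1: "r \<notin> N1" if "r \<in> R" for r
    using that R_unique E_\<rho> arcD(3) unfolding N1_def by fastforce
  \<comment> \<open>With \<open>r\<close> the root, the three values are \<open>s r\<close>,
    \<open>s r + 1\<close> and \<open>s r + 2\<close>. Fixing the second neighbourhood too ensures
    that all of it lies exactly two levels above the root.\<close>
  define L0 where "L0 v = (if v \<in> R then s v else if v \<in> N1 then 2 - s v else s v + 2)" for v
  define T0 where "T0 = R \<union> N1 \<union> N2"
  have T0V: "T0 \<subseteq> ?V" using arcD by (auto simp: T0_def R_def N1_def N2_def)
  \<comment> \<open>Otherwise a walk from an unlabelled vertex to its root would stay outside
    \<open>T\<close>, although \<open>T\<close> contains all roots.\<close>
  have step: "\<exists>v\<in>?V - T. \<exists>t\<in>T. (v, t) \<in> ?E" if T: "T0 \<subseteq> T" "T \<subset> ?V" for T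
  proof (rule ccontr)
    assume neg: "\<not> ?thesis"
    obtain v where v: "v \<in> ?V - T" using T by blast
    have "(v, \<rho> v) \<in> ?E\<^sup>*" by (rule \<rho>)
    then have "\<rho> v \<in> ?V - T"
      by (induction rule: rtrancl_induct) (use v neg arcD(2) in blast)+
    moreover have "\<rho> v \<in> R" using calculation \<rho>_eq[OF \<rho>(1)[of v]] by (auto simp: R_def)
    ultimately show False using T by (auto simp: T0_def)
  qed
  obtain L where L0: "\<And>v. v \<in> T0 \<Longrightarrow> L v = L0 v"
    and L: "\<And>v. v \<in> ?V \<Longrightarrow> L v < 4 \<and> L v mod 2 = s v"
    and Lp: "\<And>v. v \<in> ?V - T0 \<Longrightarrow> \<exists>t\<in>?V. (v, t) \<in> ?E \<and> L v = (L t + 1) mod 4"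
  proof (rule level_extension[of ?V T0 ?E s L0])
    show "s v = (s t + 1) mod 2" if "t \<in> ?V" "(v, t) \<in> ?E" for v t
      using s_flip[OF that(2)] s[OF that(1)] by (auto simp: less_2_cases_iff)
    show "L0 v < 4 \<and> L0 v mod 2 = s v" if "v \<in> T0" for v
    proof -
      have "s v = 0 \<or> s v = 1" using s[of v] that T0V by auto
      then show ?thesis by (auto simp: L0_def)
    qed
  qed (use T0V step in auto)
  have L_N1: "L v = L r + 1" if "r \<in> R" "(r, v) \<in> ?E" for r v
  proof -
    have "v \<in> N1" "v \<notin> R" using that RN1 by (auto simp: N1_def)
    then show ?thesis using that L0[of v] L0[of r] s_flip[OF that(2)] s[of v] arcD[OF that(2)]
      by (auto simp: T0_def L0_def less_2_cases_iff)
  qed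
  have L_N2: "L w = L u + 1" if u: "u \<in> N1" "(u, w) \<in> ?E" "w \<notin> R" for u w
  proof -
    obtain r where r: "r \<in> R" "(r, u) \<in> ?E" using u by (auto simp: N1_def)
    \<comment> \<open>Two adjacent vertices of \<open>N1\<close> would share their root and hence
      lie on the same side of the bipartition.\<close>
    have "w \<notin> N1"
    proof
      assume "w \<in> N1"
      then obtain r' where r': "r' \<in> R" "(r', w) \<in> ?E" by (auto simp: N1_def)
      then have "r' = r" using r that E_\<rho> R_unique by metis
      then show False using r r' s_flip[OF r(2)] s_flip[OF r'(2)] s_edge[OF that(2)]
          s[of u] s[of w] arcD[OF that(2)] by auto
    qed
    moreover have "u \<notin> R" "w \<in> N2" using RN1 that by (auto simp: N2_def)
    ultimately show ?thesis
      using that L0[of u] L0[of w] s_flip[OF that(2)] s[of w] arcD[OF that(2)]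
      by (auto simp: T0_def L0_def less_2_cases_iff)
  qed
  have parent: "\<exists>t. (v, t) \<in> ?E \<and> L v = (L t + 1) mod 4" if v: "v \<in> ?V" "v \<notin> R" for v
  proof -
    have lt: "L v < 4" using L v by blast
    consider "v \<in> N1" | "v \<in> N2" "v \<notin> N1" | "v \<notin> T0" using v by (auto simp: T0_def)
    then show ?thesis
    proof cases
      case 1
      then show ?thesis using L_N1 arcD(4) lt by (fastforce simp: N1_def)
    next
      case 2
      then show ?thesis using L_N2 arcD(4) lt v(2) by (fastforce simp: N2_def)
    next
      case 3
      then show ?thesis using Lp v by blast
    qed
  qed
  \<comment> \<open>All neighbours of \<open>v\<close> have the other parity. So a level with the
    parity of \<open>v\<close> but different from \<open>L v\<close> is absent around
    \<open>v\<close>.\<close>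
  have own: "k = L v" if "k \<in> L ` closed_nbhd G v" "k mod 2 = L v mod 2" "v \<in> ?V" for k v
    using that L s_edge arcD(2) by (fastforce simp: closed_nbhd_def)
  \<comment> \<open>The level of the parent of \<open>u\<close> is seen by \<open>u\<close> and not
    by \<open>v\<close>. A root need not have a parent, but being good it leaves \<open>v\<close> a
    second neighbour, on level \<open>L u + 2\<close>, which the root does not see.\<close>
  have up: "L ` closed_nbhd G u \<noteq> L ` closed_nbhd G v"
    if uv: "(u, v) \<in> ?E" "L v = (L u + 1) mod 4" for u v
  proof (cases "u \<in> R")
    case True
    then obtain w where w: "w \<noteq> u" "(v, w) \<in> ?E" using \<rho>(2)[of u] uv by (auto simp: R_def good_def)
    have vN1: "v \<in> N1" using True uv by (auto simp: N1_def)
    have "w \<notin> R" using w True R_unique E_\<rho> uv by metis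
    then have "L w = L u + 2" using L_N2[OF vN1 w(2)] L_N1[OF True uv(1)] by simp
    moreover have "L w \<in> L ` closed_nbhd G v" using w by (auto simp: closed_nbhd_def)
    ultimately show ?thesis using own[of "L w" u] arcD[OF uv(1)] by auto
  next
    case False
    then obtain t where t: "(u, t) \<in> ?E" "L u = (L t + 1) mod 4" using parent arcD[OF uv(1)] by blast
    have "L t mod 2 = L v mod 2" "L t \<noteq> L v"
      using mod_4_succ_succ[OF _ t(2) uv(2)] L arcD[OF t(1)] by auto
    moreover have "L t \<in> L ` closed_nbhd G u" using t by (auto simp: closed_nbhd_def)
    ultimately show ?thesis using own[of "L t" v] arcD[OF uv(1)] by auto
  qed
  have "lid_chromatic_number G \<le> card {..<4::nat}"
  proof (rule lid_chromatic_number_le_card[OF G, where c = L])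
    fix u v assume uv: "(u, v) \<in> ?E"
    have par: "L u mod 2 \<noteq> L v mod 2" using L s_edge[OF uv] arcD[OF uv] by metis
    then show "L u \<noteq> L v" by auto
    have "L v = (L u + 1) mod 4 \<or> L u = (L v + 1) mod 4"
      using par L[of u] L[of v] arcD[OF uv] mod_4_consecutive by blast
    then show "L ` closed_nbhd G u \<noteq> L ` closed_nbhd G v"
      using up[of u v] up[of v u] uv arcD[OF uv] by metis
  qed (use L in auto)
  then show ?thesis by simp
qed

section \<open>Greedy colorings and their two-colored part\<close>

text \<open>A proper coloring with the least sum of colors will do: moving a vertex to a smaller
  color missing around it would stay proper and lower the sum.\<close>

lemma greedy_coloring_exists:
  assumes G: "pair_graph G" and ex: "\<exists>f. proper_coloring G k f"
  obtains f where "proper_coloring G k f"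
    and "\<And>v j. v \<in> pverts G \<Longrightarrow> 1 \<le> j \<Longrightarrow> j < f v \<Longrightarrow> \<exists>w. (v, w) \<in> parcs G \<and> f w = j"
proof -
  interpret pair_graph G by fact
  obtain f where f: "proper_coloring G k f"
    and min: "\<And>f'. proper_coloring G k f' \<Longrightarrow> sum f (pverts G) \<le> sum f' (pverts G)"
    using ex_has_least_nat[of "proper_coloring G k" _ "\<lambda>f. sum f (pverts G)"] ex by blast
  have "\<exists>w. (v, w) \<in> parcs G \<and> f w = j" if v: "v \<in> pverts G" "1 \<le> j" "j < f v" for v j
  proof (rule ccontr)
    assume neg: "\<not> ?thesis"
    have "f v \<le> k" using f v(1) unfolding proper_coloring_def by auto
    then have "(f(v := j)) ` pverts G \<subseteq> {1..k}"
      using f v unfolding proper_coloring_def by (auto simp: image_subset_iff)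
    moreover have "(f(v := j)) x \<noteq> (f(v := j)) y" if xy: "(x, y) \<in> parcs G" for x y
    proof -
      have "f x \<noteq> f y" using f xy unfolding proper_coloring_def by blast
      moreover have "x = v \<Longrightarrow> f y \<noteq> j" "y = v \<Longrightarrow> f x \<noteq> j" "x \<noteq> y"
        using neg xy pair_graph_arcD(3,4)[OF G xy] by blast+
      ultimately show ?thesis by auto
    qed
    ultimately have "proper_coloring G k (f(v := j))" unfolding proper_coloring_def by blast
    then have "sum f (pverts G) \<le> sum (f(v := j)) (pverts G)" by (rule min)
    moreover have "sum (f(v := j)) (pverts G) < sum f (pverts G)"
      by (rule sum_strict_mono_ex1) (use v in auto)
    ultimately show False by simp
  qed
  then show ?thesis using that f by blast
qed

definition two_colored_part :: "'a pair_pre_digraph \<Rightarrow> ('a \<Rightarrow> nat) \<Rightarrow> 'a set" where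
  "two_colored_part G f = {v \<in> pverts G. f v \<le> 2 \<and> (\<forall>w. (v, w) \<in> parcs G \<longrightarrow> f w \<le> 2)}"

lemma proper_coloring_range: "proper_coloring G k f \<Longrightarrow> v \<in> pverts G \<Longrightarrow> 1 \<le> f v \<and> f v \<le> k"
  by (auto simp: proper_coloring_def)

lemma proper_coloring_arc: "proper_coloring G k f \<Longrightarrow> (u, v) \<in> parcs G \<Longrightarrow> f u \<noteq> f v"
  by (auto simp: proper_coloring_def)

lemma two_colored_part_colors:
  assumes "pair_graph G" "proper_coloring G k f" "v \<in> two_colored_part G f"
  shows "f v = 1 \<or> f v = 2" "(v, w) \<in> parcs G \<Longrightarrow> f w = 3 - f v"
proof -
  show v: "f v = 1 \<or> f v = 2"
    using proper_coloring_range[OF assms(2), of v] assms(3) by (auto simp: two_colored_part_def)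
  show "f w = 3 - f v" if vw: "(v, w) \<in> parcs G"
    using proper_coloring_range[OF assms(2), of w] proper_coloring_arc[OF assms(2) vw] v vw assms(3)
      pair_graph_arcD[OF assms(1) vw] by (auto simp: two_colored_part_def)
qed

text \<open>An endpoint of color at least 3 sees colors 1 and 2, one of which is not the color of
  the other endpoint; the neighbour carrying it is outside the part because it sees that endpoint.
  If both endpoints have color at most 2, \<open>u\<close> must have a neighbour of color above 2.
  Staying outside the part lets the witness keep its product color later.\<close>

lemma greedy_distinguishing_neighbour:
  assumes G: "pair_graph G" and f: "proper_coloring G k f"
    and greedy: "\<And>v j. v \<in> pverts G \<Longrightarrow> 1 \<le> j \<Longrightarrow> j < f v \<Longrightarrow> \<exists>w. (v, w) \<in> parcs G \<and> f w = j"
    and uv: "(u, v) \<in> parcs G" and u: "u \<notin> two_colored_part G f"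
  shows "(\<exists>n. n \<notin> two_colored_part G f \<and> (u, n) \<in> parcs G \<and> f n \<noteq> f v) \<or>
         (\<exists>n. n \<notin> two_colored_part G f \<and> (v, n) \<in> parcs G \<and> f n \<noteq> f u)"
proof -
  note arcD = pair_graph_arcD[OF G]
  have high: "\<exists>n. n \<notin> two_colored_part G f \<and> (x, n) \<in> parcs G \<and> f n \<noteq> c"
    if x: "x \<in> pverts G" "f x \<ge> 3" for x c
  proof -
    define j where "j = (if c = 1 then 2 else 1::nat)"
    have "1 \<le> j" "j < f x" using x(2) by (auto simp: j_def)
    then obtain n where n: "(x, n) \<in> parcs G" "f n = j" using greedy x(1) by blast
    then have "n \<notin> two_colored_part G f"
      using arcD(4)[OF n(1)] x(2) by (auto simp: two_colored_part_def)
    moreover have "j \<noteq> c" by (auto simp: j_def)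
    ultimately show ?thesis using n by blast
  qed
  consider "f u \<ge> 3" | "f v \<ge> 3" | "f u \<le> 2" "f v \<le> 2" by linarith
  then show ?thesis
  proof cases
    case 3
    then obtain n where n: "(u, n) \<in> parcs G" "f n > 2"
      using u arcD[OF uv] by (auto simp: two_colored_part_def not_le)
    then have "n \<notin> two_colored_part G f" "f n \<noteq> f v" using 3 by (auto simp: two_colored_part_def)
    then show ?thesis using n by blast
  qed (use high arcD[OF uv] in blast)+
qed

section \<open>Products of two graphs of chromatic number at least 3\<close>

lemma nonbipartite_tensor_product_lid:
  fixes G :: "'a pair_pre_digraph" and H :: "'b pair_pre_digraph"
  assumes G: "pair_graph G" and H: "pair_graph H"
    and connG: "Digraph_Component.connected (with_proj G)"
    and nbH: "\<And>v. v \<in> pverts H \<Longrightarrow> \<exists>w. (v, w) \<in> parcs H"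
    and k: "chromatic_number G \<ge> 3" and l: "chromatic_number H \<ge> 3"
  shows "lid_chromatic_number (tensor_product G H) \<le> chromatic_number G * chromatic_number H"
proof -
  define k where "k = chromatic_number G"
  define l where "l = chromatic_number H"
  note kl = k[folded k_def] l[folded l_def]
  obtain f where f: "proper_coloring G k f" and
    gf: "\<And>v j. v \<in> pverts G \<Longrightarrow> 1 \<le> j \<Longrightarrow> j < f v \<Longrightarrow> \<exists>w. (v, w) \<in> parcs G \<and> f w = j"
    using greedy_coloring_exists[OF G proper_coloring_chromatic_number[OF G]] unfolding k_def by blast
  obtain g where g: "proper_coloring H l g" and
    gg: "\<And>v j. v \<in> pverts H \<Longrightarrow> 1 \<le> j \<Longrightarrow> j < g v \<Longrightarrow> \<exists>w. (v, w) \<in> parcs H \<and> g w = j"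
    using greedy_coloring_exists[OF H proper_coloring_chromatic_number[OF H]] unfolding l_def by blast
  define X where "X = two_colored_part G f"
  define Y where "Y = two_colored_part H g"
  define S where "S = X \<times> Y"
  let ?T = "tensor_product G H"
  let ?E = "parcs ?T" and ?V = "pverts ?T"
  have T: "pair_graph ?T" using pair_graph_tensor_product G H by blast
  interpret T: pair_graph ?T by (rule T)
  note GD = pair_graph_arcD[OF G] and HD = pair_graph_arcD[OF H] and TD = pair_graph_arcD[OF T]
  note fX = two_colored_part_colors[OF G f, folded X_def]
  note gY = two_colored_part_colors[OF H g, folded Y_def]
  have SV: "S \<subseteq> ?V" by (auto simp: S_def X_def Y_def two_colored_part_def)
  \<comment> \<open>On edges meeting \<open>S\<close> the first color swaps 1 and 2, so there
    \<open>s\<close> acts as a bipartition. Outside \<open>S\<close> it is the level itself.\<close>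
  define s where "s p = (if f (fst p) = 1 then 0 else 1::nat)" for p :: "'a \<times> 'b"
  define T0 where "T0 = (?V - S) \<union> {p \<in> S. \<exists>q. q \<notin> S \<and> (p, q) \<in> ?E}"
  \<comment> \<open>For a vertex of \<open>S\<close> next to the complement, this is one above the
    level, 1 or 0, of its outer neighbours, which thereby serve as parents.\<close>
  define L0 where "L0 p = (if p \<notin> S then s p else if f (fst p) = 1 then 2 else 1)" for p
  have T0V: "T0 \<subseteq> ?V" using SV by (auto simp: T0_def)
  have XG: "X \<noteq> pverts G"
  proof
    assume "X = pverts G"
    then have "f ` pverts G \<subseteq> {1..2}" using fX(1) by fastforce
    then have "proper_coloring G 2 f" using f by (auto simp: proper_coloring_def)
    then show False using chromatic_number_le k by fastforce
  qed
  have s_flip: "s p = (s q + 1) mod 2" if "p \<in> S" "(p, q) \<in> ?E" for p q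
  proof -
    obtain a b a' b' where [simp]: "p = (a, b)" "q = (a', b')" by (cases p, cases q)
    show ?thesis using fX(1)[of a] fX(2)[of a a'] that by (auto simp: s_def S_def)
  qed
  \<comment> \<open>Otherwise the projection of the unlabelled set to \<open>G\<close> is closed
    under adjacency, each arc of \<open>G\<close> being lifted along some arc of \<open>H\<close>.
    It would be all of \<open>G\<close>, yet it lies in \<open>X\<close>.\<close>
  have step: "\<exists>p\<in>?V - U. \<exists>q\<in>U. (p, q) \<in> ?E" if U: "T0 \<subseteq> U" "U \<subset> ?V" for U
  proof (rule ccontr)
    assume neg: "\<not> ?thesis"
    have "fst ` (?V - U) = pverts G"
    proof (rule connected_closed_subset_eq[OF G connG])
      fix a a' assume "a \<in> fst ` (?V - U)" and a': "(a, a') \<in> parcs G"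
      then obtain b where b: "(a, b) \<in> ?V - U" by force
      then obtain b' where b': "(b, b') \<in> parcs H" using nbH by auto
      then have "((a, b), (a', b')) \<in> ?E" using a' by simp
      then have "(a', b') \<in> ?V - U" using neg b TD(2) by blast
      then show "a' \<in> fst ` (?V - U)" by force
    qed (use U in auto)
    moreover have "fst ` (?V - U) \<subseteq> X" using U by (auto simp: T0_def S_def)
    ultimately show False using XG by (auto simp: X_def two_colored_part_def)
  qed
  obtain L where L0: "\<And>v. v \<in> T0 \<Longrightarrow> L v = L0 v"
    and L: "\<And>v. v \<in> ?V \<Longrightarrow> L v < 4 \<and> L v mod 2 = s v"
    and Lp: "\<And>v. v \<in> ?V - T0 \<Longrightarrow> \<exists>t\<in>?V. (v, t) \<in> ?E \<and> L v = (L t + 1) mod 4"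
  proof (rule level_extension[of ?V T0 ?E s L0])
    show "s v = (s t + 1) mod 2" if "v \<in> ?V - T0" "t \<in> ?V" "(v, t) \<in> ?E" for v t
      using that s_flip[of v t] by (auto simp: T0_def)
    show "L0 v < 4 \<and> L0 v mod 2 = s v" if "v \<in> T0" for v
      by (auto simp: L0_def s_def)
  qed (use T.pair_finite_verts T0V step in blast)+
  have L_out: "L q = s q" if "q \<in> ?V" "q \<notin> S" for q
    using L0[of q] that by (auto simp: T0_def L0_def)
  have parent: "\<exists>q. (p, q) \<in> ?E \<and> L p = (L q + 1) mod 4" if p: "p \<in> S" for p
  proof (cases "p \<in> T0")
    case True
    then obtain q where q: "q \<notin> S" "(p, q) \<in> ?E" using p by (auto simp: T0_def)
    have "L p = (L q + 1) mod 4"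
      using L0[OF True] L_out[OF TD(2)[OF q(2)] q(1)] s_flip[OF p q(2)] p
      by (auto simp: L0_def s_def split: if_splits)
    then show ?thesis using q by blast
  next
    case False
    then show ?thesis using Lp[of p] p SV by blast
  qed
  have attached: "L p = (if f (fst p) = 1 then 2 else 1)" if "p \<in> S" "(p, q) \<in> ?E" "q \<notin> S" for p q
  proof -
    have "p \<in> T0" using that unfolding T0_def by blast
    then show ?thesis using L0[of p] that(1) by (simp add: L0_def)
  qed

  define c where "c p = (if p \<in> S \<and> L p = 2 then (3, 3) else if p \<in> S \<and> L p = 3 then (1, g (snd p))
    else (f (fst p), g (snd p)))" for p
  \<comment> \<open>\<open>K d j\<close> is the color on level \<open>j\<close> around a vertex of \<open>S\<close>, where \<open>d\<close> is the
    second coordinate of the product color on the even levels.\<close>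
  define K where "K d j = (if j = 0 then (1::nat, d) else if j = 1 then (2, 3 - d)
    else if j = 2 then (3, 3) else (1, 3 - d))" for d j :: nat
  \<comment> \<open>Along an edge at \<open>S\<close> both colors swap 1 and 2, so \<open>e\<close>
    is constant there. For fixed \<open>d\<close> in \<open>{1, 2}\<close> the four colors
    \<open>K d j\<close> are distinct, and colors around a vertex of \<open>S\<close> determine
    levels.\<close>
  define e where "e p = (if f (fst p) = 1 then g (snd p) else 3 - g (snd p))" for p
  have e12: "e p = 1 \<or> e p = 2" if "p \<in> S" for p
    using that gY(1)[of "snd p"] by (auto simp: e_def S_def)
  have K_inj: "i = j" if "K d i = K d j" "i < 4" "j < 4" "d = 1 \<or> d = 2" for d i j
    using that by (auto simp: K_def split: if_splits)
  have c_self: "c p = K (e p) (L p)" if p: "p \<in> S" for p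
  proof -
    obtain a b where [simp]: "p = (a, b)" by (cases p)
    have ab: "a \<in> X" "b \<in> Y" using p by (auto simp: S_def)
    have Lp4: "L p \<in> {0, 1, 2, 3}" "L p mod 2 = s p" using L[of p] p SV by auto
    show ?thesis using Lp4 fX(1)[OF ab(1)] gY(1)[OF ab(2)] p
      by (auto simp: c_def K_def e_def s_def)
  qed
  have e_nb: "e q = e p" if p: "p \<in> S" and q: "(p, q) \<in> ?E" for p q
  proof -
    obtain a b a' b' where [simp]: "p = (a, b)" "q = (a', b')" by (cases p, cases q)
    show ?thesis using p q fX(1)[of a] fX(2)[of a a'] gY(1)[of b] gY(2)[of b b'] by (auto simp: S_def e_def)
  qed
  have c_nb: "c q = K (e p) (L q)" if p: "p \<in> S" and q: "(p, q) \<in> ?E" for p q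
  proof (cases "q \<in> S")
    case True
    then show ?thesis using c_self e_nb[OF p q] by simp
  next
    case False
    obtain a b a' b' where [simp]: "p = (a, b)" "q = (a', b')" by (cases p, cases q)
    show ?thesis using False p q fX(1)[of a] fX(2)[of a a'] gY(1)[of b] gY(2)[of b b'] L_out[OF TD(2)[OF q] False]
      by (auto simp: S_def e_def s_def c_def K_def)
  qed
  have c_nbhd: "\<exists>r. r \<in> closed_nbhd ?T p \<and> x = K (e p) (L r)"
    if "p \<in> S" "x \<in> c ` closed_nbhd ?T p" for p x
    using that c_self c_nb unfolding closed_nbhd_def by blast

  \<comment> \<open>As in the bipartite case, the color of the parent of \<open>p\<close> is missing
    around \<open>q\<close>. Every vertex of \<open>S\<close> has a parent, so no root needs
    separate care.\<close>
  have lid_SS: "c ` closed_nbhd ?T p \<noteq> c ` closed_nbhd ?T q"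
    if p: "p \<in> S" and q: "q \<in> S" and pq: "(p, q) \<in> ?E" and lev: "L q = (L p + 1) mod 4" for p q
  proof
    assume eq: "c ` closed_nbhd ?T p = c ` closed_nbhd ?T q"
    obtain t where t: "(p, t) \<in> ?E" "L p = (L t + 1) mod 4" using parent p by blast
    have t4: "L t < 4" using L TD(2)[OF t(1)] by blast
    have "c t \<in> c ` closed_nbhd ?T q" unfolding eq[symmetric] using t by (auto simp: closed_nbhd_def)
    then obtain r where r: "r \<in> closed_nbhd ?T q" "K (e p) (L t) = K (e q) (L r)"
      using c_nbhd[OF q] c_nb[OF p t(1)] by metis
    have "r \<in> ?V" using r(1) TD(2) q SV unfolding closed_nbhd_def by blast
    then have "L t = L r" using K_inj r(2) e_nb[OF p pq] e12[OF p] t4 L by metis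
    moreover have "L t mod 2 = L q mod 2" "L t \<noteq> L q" using mod_4_succ_succ[OF t4 t(2) lev] by auto
    ultimately have "r \<noteq> q" "L r mod 2 = L q mod 2" by auto
    moreover have "L r mod 2 \<noteq> L q mod 2" if "(q, r) \<in> ?E"
      using L[OF TD(1)[OF that]] L[OF TD(2)[OF that]] s_flip[OF q that] by (auto simp: s_def)
    ultimately show False using r(1) by (auto simp: closed_nbhd_def)
  qed

  \<comment> \<open>Around \<open>p\<close> a color is either \<open>(3, 3)\<close> or has both
    coordinates at most 2. Around \<open>q\<close> there is a mixed one: a neighbour of color above
    2 in one factor, paired with the coordinate of \<open>p\<close> in the other.\<close>
  have lid_S_out: "c ` closed_nbhd ?T p \<noteq> c ` closed_nbhd ?T q"
    if p: "p \<in> S" and q: "q \<notin> S" and pq: "(p, q) \<in> ?E" for p q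
  proof -
    obtain a b a' b' where [simp]: "p = (a, b)" "q = (a', b')" by (cases p, cases q)
    have ab: "a \<in> X" "b \<in> Y" using p by (auto simp: S_def)
    have arcs: "(a, a') \<in> parcs G" "(b, b') \<in> parcs H" using pq by auto
    have low: "f a \<le> 2" "g b \<le> 2" "f a' \<le> 2" "g b' \<le> 2"
      using fX[OF ab(1)] gY[OF ab(2)] arcs by fastforce+
    have "\<exists>x \<in> c ` closed_nbhd ?T q. (fst x \<ge> 3 \<and> snd x \<le> 2) \<or> (fst x \<le> 2 \<and> snd x \<ge> 3)"
    proof (cases "a' \<in> X")
      case False
      then obtain n where n: "(a', n) \<in> parcs G" "f n > 2"
        using GD[OF arcs(1)] low by (auto simp: X_def two_colored_part_def not_le)
      have "(n, b) \<notin> S" using n(2) by (auto simp: S_def X_def two_colored_part_def)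
      then have "c (n, b) = (f n, g b)" by (simp add: c_def)
      moreover have "(n, b) \<in> closed_nbhd ?T q" using n HD[OF arcs(2)] by (simp add: closed_nbhd_def)
      ultimately have "(f n, g b) \<in> c ` closed_nbhd ?T q" by (metis imageI)
      then show ?thesis using n(2) low by (intro bexI[of _ "(f n, g b)"]) auto
    next
      case True
      then have "b' \<notin> Y" using q by (auto simp: S_def)
      then obtain n where n: "(b', n) \<in> parcs H" "g n > 2"
        using HD[OF arcs(2)] low by (auto simp: Y_def two_colored_part_def not_le)
      have "(a, n) \<notin> S" using n(2) by (auto simp: S_def Y_def two_colored_part_def)
      then have "c (a, n) = (f a, g n)" by (simp add: c_def)
      moreover have "(a, n) \<in> closed_nbhd ?T q" using n GD[OF arcs(1)] by (simp add: closed_nbhd_def)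
      ultimately have "(f a, g n) \<in> c ` closed_nbhd ?T q" by (metis imageI)
      then show ?thesis using n(2) low by (intro bexI[of _ "(f a, g n)"]) auto
    qed
    moreover have "\<not> ((fst x \<ge> 3 \<and> snd x \<le> 2) \<or> (fst x \<le> 2 \<and> snd x \<ge> 3))"
      if "x \<in> c ` closed_nbhd ?T p" for x
      using c_nbhd[OF p that] e12[OF p] by (auto simp: K_def split: if_splits)
    ultimately show ?thesis by blast
  qed

  \<comment> \<open>Vertices of \<open>S\<close> adjacent to a vertex \<open>z\<close> outside \<open>S\<close> only ever get recolored to \<open>(3, 3)\<close>,
    and then both coordinates of the color of \<open>z\<close> are at most 2. So no neighbour of \<open>z\<close> shares
    a coordinate with it.\<close>
  have out_coords: "x = (f z1, g z2) \<or> (fst x \<noteq> f z1 \<and> snd x \<noteq> g z2)"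
    if z: "(z1, z2) \<notin> S" and x: "x \<in> c ` closed_nbhd ?T (z1, z2)" for x z1 z2
  proof -
    from x obtain q where q: "x = c q" "q = (z1, z2) \<or> ((z1, z2), q) \<in> ?E"
      by (auto simp: closed_nbhd_def)
    obtain a b where [simp]: "q = (a, b)" by (cases q)
    consider "q = (z1, z2)" | "((z1, z2), q) \<in> ?E" "q \<notin> S" | "((z1, z2), q) \<in> ?E" "q \<in> S"
      using q(2) by blast
    then show ?thesis
    proof cases
      case 1
      then show ?thesis using z q by (simp add: c_def)
    next
      case 2
      then show ?thesis using q proper_coloring_arc[OF f, of z1 a] proper_coloring_arc[OF g, of z2 b]
        by (auto simp: c_def)
    next
      case 3
      have arcs: "(a, z1) \<in> parcs G" "(b, z2) \<in> parcs H" using 3 GD(4) HD(4) by auto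
      have ab: "a \<in> X" "b \<in> Y" using 3 by (auto simp: S_def)
      have "L q = 2 \<or> L q = 1" using attached[of q "(z1, z2)"] z 3 arcs by (auto split: if_splits)
      then have "x = (3, 3) \<or> x = (f a, g b)" using q(1) by (auto simp: c_def)
      moreover have "f z1 \<noteq> f a \<and> f z1 \<noteq> 3"
        using fX(1)[OF ab(1)] fX(2)[OF ab(1) arcs(1)] by linarith
      moreover have "g z2 \<noteq> g b \<and> g z2 \<noteq> 3"
        using gY(1)[OF ab(2)] gY(2)[OF ab(2) arcs(2)] by linarith
      ultimately show ?thesis by auto
    qed
  qed
  \<comment> \<open>The color of the neighbour \<open>(n1, n2)\<close> agrees with that of
    \<open>(z1, z2)\<close> in exactly one coordinate, which \<open>out_coords\<close> rules out
    around \<open>(z1, z2)\<close>.\<close>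
  have lid_out_aux: "c ` closed_nbhd ?T (w1, w2) \<noteq> c ` closed_nbhd ?T (z1, z2)"
    if z: "(z1, z2) \<notin> S" and n: "((w1, w2), (n1, n2)) \<in> ?E" "(n1, n2) \<notin> S"
      "f n1 \<noteq> f z1 \<and> g n2 = g z2 \<or> f n1 = f z1 \<and> g n2 \<noteq> g z2" for w1 w2 z1 z2 n1 n2
  proof -
    have "c (n1, n2) = (f n1, g n2)" using n by (simp add: c_def)
    moreover have "(n1, n2) \<in> closed_nbhd ?T (w1, w2)" using n(1) by (simp add: closed_nbhd_def)
    ultimately have "(f n1, g n2) \<in> c ` closed_nbhd ?T (w1, w2)" by (metis imageI)
    moreover have "(f n1, g n2) \<notin> c ` closed_nbhd ?T (z1, z2)"
      using out_coords[OF z, of "(f n1, g n2)"] n(3) by auto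
    ultimately show ?thesis by blast
  qed
  \<comment> \<open>The agreeing coordinate is copied from the opposite endpoint, the differing one
    comes from the greedy witness in the factor where an endpoint leaves \<open>X\<close> or
    \<open>Y\<close>.\<close>
  have lid_out: "c ` closed_nbhd ?T w \<noteq> c ` closed_nbhd ?T z"
    if w: "w \<notin> S" and z: "z \<notin> S" and wz: "(w, z) \<in> ?E" for w z
  proof -
    obtain w1 w2 z1 z2 where eq [simp]: "w = (w1, w2)" "z = (z1, z2)" by (cases w, cases z)
    have arcs: "(w1, z1) \<in> parcs G" "(w2, z2) \<in> parcs H" using wz by auto
    note Ga = GD[OF arcs(1)] and Ha = HD[OF arcs(2)]
    show ?thesis
    proof (cases "w1 \<in> X \<and> z1 \<in> X")
      case False
      then have "(\<exists>n. n \<notin> X \<and> (w1, n) \<in> parcs G \<and> f n \<noteq> f z1) \<or>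
                 (\<exists>n. n \<notin> X \<and> (z1, n) \<in> parcs G \<and> f n \<noteq> f w1)"
        using greedy_distinguishing_neighbour[OF G f gf arcs(1)]
          greedy_distinguishing_neighbour[OF G f gf Ga(4)] unfolding X_def by blast
      then show ?thesis
      proof (elim disjE exE conjE)
        fix n assume "n \<notin> X" "(w1, n) \<in> parcs G" "f n \<noteq> f z1"
        then show ?thesis using lid_out_aux[of z1 z2 w1 w2 n z2] z arcs by (simp add: S_def)
      next
        fix n assume "n \<notin> X" "(z1, n) \<in> parcs G" "f n \<noteq> f w1"
        then show ?thesis using lid_out_aux[of w1 w2 z1 z2 n w2] w Ha by (simp add: S_def)
      qed
    next
      case True
      then have "w2 \<notin> Y" using w by (auto simp: S_def)
      then have "(\<exists>n. n \<notin> Y \<and> (w2, n) \<in> parcs H \<and> g n \<noteq> g z2) \<or>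
                 (\<exists>n. n \<notin> Y \<and> (z2, n) \<in> parcs H \<and> g n \<noteq> g w2)"
        using greedy_distinguishing_neighbour[OF H g gg arcs(2)] unfolding Y_def by blast
      then show ?thesis
      proof (elim disjE exE conjE)
        fix n assume "n \<notin> Y" "(w2, n) \<in> parcs H" "g n \<noteq> g z2"
        then show ?thesis using lid_out_aux[of z1 z2 w1 w2 z1 n] z arcs by (simp add: S_def)
      next
        fix n assume "n \<notin> Y" "(z2, n) \<in> parcs H" "g n \<noteq> g w2"
        then show ?thesis using lid_out_aux[of w1 w2 z1 z2 w1 n] w Ga by (simp add: S_def)
      qed
    qed
  qed

  have proper_S: "c p \<noteq> c q" if p: "p \<in> S" and pq: "(p, q) \<in> ?E" for p q
  proof
    assume "c p = c q"
    then have "L p = L q"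
      using K_inj[of "e p" "L p" "L q"] c_self[OF p] c_nb[OF p pq] e12[OF p] L TD(1,2)[OF pq] by metis
    then show False
      using L[OF TD(1)[OF pq]] L[OF TD(2)[OF pq]] s_flip[OF p pq] by (auto simp: s_def split: if_splits)
  qed
  have "lid_chromatic_number ?T \<le> card ({1..k} \<times> {1..l})"
  proof (rule lid_chromatic_number_le_card[OF T, where c = c])
    \<comment> \<open>The color \<open>(3, 3)\<close> is available because both chromatic numbers
      are at least 3.\<close>
    show "c ` ?V \<subseteq> {1..k} \<times> {1..l}"
      using kl proper_coloring_range[OF f] proper_coloring_range[OF g]
      by (auto simp: c_def)
  next
    fix p q assume pq: "(p, q) \<in> ?E"
    note qp = TD(4)[OF pq]
    show "c p \<noteq> c q"
    proof (cases "p \<in> S \<or> q \<in> S")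
      case True
      then show ?thesis using proper_S[of p q] proper_S[of q p] pq qp by metis
    next
      case False
      then show ?thesis
        using pq proper_coloring_arc[OF f] by (cases p, cases q) (auto simp: c_def)
    qed
    show "c ` closed_nbhd ?T p \<noteq> c ` closed_nbhd ?T q"
    proof (cases "p \<in> S \<and> q \<in> S")
      case True
      have "L p mod 2 \<noteq> L q mod 2"
        using L[OF TD(1)[OF pq]] L[OF TD(2)[OF pq]] s_flip[OF _ pq] True by (auto simp: s_def split: if_splits)
      then have "L q = (L p + 1) mod 4 \<or> L p = (L q + 1) mod 4"
        using mod_4_consecutive L TD(1,2)[OF pq] by blast
      then show ?thesis using lid_SS[of p q] lid_SS[of q p] True pq qp by metis
    next
      case False
      then show ?thesis using lid_S_out[of p q] lid_S_out[of q p] lid_out[of p q] pq qp by metis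
    qed
  qed simp
  then show ?thesis by (simp add: k_def l_def)
qed

section \<open>Combining the bipartite and nonbipartite cases\<close>

text \<open>Taking \<open>s\<close> on pairs lets a 2-coloring of either factor be used after
  projection; subtracting 1 turns it into parities.\<close>

lemma bipartite_tensor_product_lid_le_4:
  fixes s :: "'a \<times> 'b \<Rightarrow> nat"
  assumes "pair_graph G" "pair_graph H"
    and "Digraph_Component.connected (with_proj G)" "Digraph_Component.connected (with_proj H)"
    and "card (pverts G) \<ge> 3 \<or> card (pverts H) \<ge> 3"
    and "\<And>p. p \<in> pverts G \<times> pverts H \<Longrightarrow> s p \<in> {1..2}"
    and "\<And>p q. (p, q) \<in> parcs (tensor_product G H) \<Longrightarrow> s p \<noteq> s q"
  shows "lid_chromatic_number (tensor_product G H) \<le> 4"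
proof (rule bipartite_lid_chromatic_number_le_4[where s = "\<lambda>p. s p - 1"])
  show "pair_graph (tensor_product G H)" using assms pair_graph_tensor_product by blast
  fix p q assume pq: "(p, q) \<in> parcs (tensor_product G H)"
  show "s p - 1 \<noteq> s q - 1"
    using assms(6)[of p] assms(6)[of q] assms(7)[OF pq]
      pair_graph_arcD[OF \<open>pair_graph (tensor_product G H)\<close> pq] by auto
  show "(\<exists>r. r \<noteq> q \<and> (p, r) \<in> parcs (tensor_product G H)) \<or>
         (\<exists>r. r \<noteq> p \<and> (q, r) \<in> parcs (tensor_product G H))"
    using tensor_product_no_isolated_edge assms pq by blast
next
  fix p assume "p \<in> pverts (tensor_product G H)"
  then show "s p - 1 < 2" using assms(6)[of p] by auto
qed

theorem theorem7:
  fixes G :: "'a pair_pre_digraph" and H :: "'b pair_pre_digraph"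
  assumes "pair_graph G" and "pair_graph H"
    and "Digraph_Component.connected (with_proj G)" and "Digraph_Component.connected (with_proj H)"
    and "card (pverts G) \<ge> 2" and "card (pverts H) \<ge> 2"
    and "card (pverts G) \<ge> 3 \<or> card (pverts H) \<ge> 3"
  shows "lid_chromatic_number (tensor_product G H) \<le> chromatic_number G * chromatic_number H"
proof -
  have ne: "pverts G \<noteq> {}" "pverts H \<noteq> {}" using assms(5,6) by auto
  note nbG = connected_has_neighbour[OF assms(1,3,5)] and nbH = connected_has_neighbour[OF assms(2,4,6)]
  have G2: "chromatic_number G \<ge> 2" using chromatic_number_ge_2[OF assms(1)] ne nbG by blast
  have H2: "chromatic_number H \<ge> 2" using chromatic_number_ge_2[OF assms(2)] ne nbH by blast
  obtain f where f: "proper_coloring G (chromatic_number G) f"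
    using proper_coloring_chromatic_number[OF assms(1)] by blast
  obtain g where g: "proper_coloring H (chromatic_number H) g"
    using proper_coloring_chromatic_number[OF assms(2)] by blast
  \<comment> \<open>Each factor has an edge, so the four levels of the bipartite case never exceed
    the bound.\<close>
  have four: "4 \<le> chromatic_number G * chromatic_number H" using mult_le_mono[OF G2 H2] by simp
  note bip = bipartite_tensor_product_lid_le_4[OF assms(1-4,7)]
  consider "chromatic_number G = 2" | "chromatic_number H = 2"
    | "chromatic_number G \<ge> 3" "chromatic_number H \<ge> 3" using G2 H2 by linarith
  then show ?thesis
  proof cases
    case 1
    have "lid_chromatic_number (tensor_product G H) \<le> 4"
    proof (rule bip[where s = "\<lambda>p. f (fst p)"])
      show "f (fst p) \<in> {1..2}" if "p \<in> pverts G \<times> pverts H" for p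
        using proper_coloring_range[OF f] 1 that by auto
      show "f (fst p) \<noteq> f (fst q)" if "(p, q) \<in> parcs (tensor_product G H)" for p q
        using proper_coloring_arc[OF f] that by (cases p, cases q) auto
    qed
    then show ?thesis using four by linarith
  next
    case 2
    have "lid_chromatic_number (tensor_product G H) \<le> 4"
    proof (rule bip[where s = "\<lambda>p. g (snd p)"])
      show "g (snd p) \<in> {1..2}" if "p \<in> pverts G \<times> pverts H" for p
        using proper_coloring_range[OF g] 2 that by auto
      show "g (snd p) \<noteq> g (snd q)" if "(p, q) \<in> parcs (tensor_product G H)" for p q
        using proper_coloring_arc[OF g] that by (cases p, cases q) auto
    qed
    then show ?thesis using four by linarith
  next
    case 3
    then show ?thesis using nonbipartite_tensor_product_lid[OF assms(1-3) nbH] by blast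
  qed
qed

end
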